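(* Let $\ell\geqslant1$ and $k$ be integers and let $A\subset\mathbf{Z}$ be a finite set such that every set $A'\subset\mathbf{Z}$ which is $F_\ell$-isomorphic to $A$ satisfies $\dim(A')\leqslant k$. Then $A$ is $F_\ell$-isomorphic to a subset $B\subset[-T,T]$ where $T\ll \ell^{O(k\log k)}$.
   Context: For Abelian groups $G,G'$ and $A\subset G$, $A'\subset G'$, a map $\psi:A\to A'$ is an $F_\ell$-homomorphism if whenever $a_1,\dots,a_\ell\in A$ and $\varepsilon_j\in\{-1,0,1\}$ satisfy $\sum_{j=1}^\ell\varepsilon_ja_j=0$, then $\sum_{j=1}^\ell\varepsilon_j\psi(a_j)=0$; $A$ and $A'$ are $F_\ell$-isomorphic if there is a bijective $F_\ell$-homomorphism whose inverse is an $F_\ell$-homomorphism. A set $D$ is dissociated if $\sum_{d\in D}\varepsilon_d d=0$ with $\varepsilon_d\in\{-1,0,1\}$ implies all $\varepsilon_d=0$; the additive dimension $\dim(A)$ is the size of the largest dissociated subset of $A$. $O(\cdot)$ and $\ll$ involve absolute constants.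
   Formalization: For ℓ = 1 the stated bound T ≪ 1 fails (A = {1,…,k} has dim(A') ≤ k for all isomorphic A', yet needs T ≥ k/2), so the base ℓ is replaced by max(2, ℓ); for ℓ ≥ 2 the bound is as stated. *)

theory Defs
  imports Complex_Main
begin

text \<open>Abelian groups are rendered by the class \<open>ab_group_add\<close>, which has no multiplication by
  integers; only the coefficients \<open>-1\<close>, \<open>0\<close>, \<open>1\<close> are needed.
  The value at other integers is irrelevant.\<close>

definition signed :: "int \<Rightarrow> 'a::ab_group_add \<Rightarrow> 'a" where
  "signed e x = (if e = 1 then x else if e = -1 then - x else 0)"

text \<open>The tuple \<open>a\<^sub>1, \<dots>, a\<^sub>l\<close> is indexed by \<open>{..<l}\<close> and may have repeated entries.\<close>

definition F_hom ::
  "nat \<Rightarrow> 'a::ab_group_add set \<Rightarrow> 'b::ab_group_add set \<Rightarrow> ('a \<Rightarrow> 'b) \<Rightarrow> bool" where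
  "F_hom l A A' \<psi> \<longleftrightarrow>
     \<psi> ` A \<subseteq> A' \<and>
     (\<forall>(a :: nat \<Rightarrow> 'a) (\<epsilon> :: nat \<Rightarrow> int).
        (\<forall>j<l. a j \<in> A \<and> \<epsilon> j \<in> {-1, 0, 1}) \<longrightarrow>
        (\<Sum>j<l. signed (\<epsilon> j) (a j)) = 0 \<longrightarrow>
        (\<Sum>j<l. signed (\<epsilon> j) (\<psi> (a j))) = 0)"

definition F_isomorphic ::
  "nat \<Rightarrow> 'a::ab_group_add set \<Rightarrow> 'b::ab_group_add set \<Rightarrow> bool" where
  "F_isomorphic l A A' \<longleftrightarrow>
     (\<exists>\<psi>. bij_betw \<psi> A A' \<and> F_hom l A A' \<psi> \<and> F_hom l A' A (inv_into A \<psi>))"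

text \<open>Quantifying over the finite subsets \<open>F\<close> gives the usual meaning (finite sums) also for
  infinite \<open>D\<close>; for finite \<open>D\<close> it amounts to the case \<open>F = D\<close>.\<close>

definition dissociated :: "'a::ab_group_add set \<Rightarrow> bool" where
  "dissociated D \<longleftrightarrow>
     (\<forall>F (\<epsilon> :: 'a \<Rightarrow> int).
        finite F \<longrightarrow> F \<subseteq> D \<longrightarrow> (\<forall>d\<in>F. \<epsilon> d \<in> {-1, 0, 1}) \<longrightarrow>
        (\<Sum>d\<in>F. signed (\<epsilon> d) d) = 0 \<longrightarrow> (\<forall>d\<in>F. \<epsilon> d = 0))"

text \<open>Meaningful for finite \<open>A\<close>, where the maximum is over a finite set, nonempty because the
  empty set is dissociated.\<close>

definition additive_dim :: "'a::ab_group_add set \<Rightarrow> nat" where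
  "additive_dim A = Max (card ` {D. D \<subseteq> A \<and> dissociated D})"

text \<open>In the theorem, the constant \<open>C\<close> stands for Vinogradov notation and \<open>K\<close> for the
  exponent \<open>O(k log k)\<close>. The base \<open>max 2 l\<close> is \<open>l\<close> for every \<open>l \<ge> 2\<close>. It is \<open>2\<close> when
  \<open>l = 1\<close>, as no bound \<open>C * 1\<close> can hold there: any two sets of \<open>k\<close> nonzero integers are
  \<open>F\<^sub>1\<close>-isomorphic, they have dimension at most \<open>k\<close>, and they need \<open>T \<ge> k / 2\<close>.
  For \<open>k = 0\<close> the library value \<open>ln 0 = 0\<close> makes the exponent \<open>0\<close>.\<close>

end

theory Submission
  imports Defs "HOL-Library.FuncSet" "HOL-Library.Function_Algebras"
begin

text \<open>Let \<open>D\<close> be a largest dissociated subset of \<open>A\<close>. By maximality every \<open>a \<in> A\<close> is a combination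
  of \<open>D\<close> with coefficients in \<open>{-1, 0, 1}\<close>, so every sum of \<open>l\<close> signed elements of \<open>A\<close> is an integer
  linear form in the elements of \<open>D\<close> with coefficients at most \<open>l\<close>. It therefore suffices to replace
  the vector \<open>y = (d)\<^sub>d\<close> by a short integer vector \<open>x\<close> annihilated by the same forms of height at most
  \<open>m = max 2 l\<close>; height \<open>2\<close> is what injectivity needs.

  For a form \<open>f\<close> with \<open>f y \<noteq> 0\<close>, extend \<open>f\<close> and a basis of the relations of \<open>y\<close> to a basis of the
  space of all forms, using forms of height at most \<open>m\<close>. Siegel's lemma gives a short nonzero \<open>v\<close>
  killed by this basis without \<open>f\<close>. Then \<open>f v \<noteq> 0\<close>, as otherwise the whole basis would kill \<open>v\<close>.
  A combination of these \<open>v\<close>, one for each of the at most \<open>(2 m + 1)\<^sup>k\<close> forms \<open>f\<close>, with small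
  coefficients chosen greedily, is the required \<open>x\<close>.\<close>

section \<open>Linear forms and Siegel's lemma\<close>

text \<open>The value at \<open>x\<close> of the linear form with coefficients \<open>f\<close>. The
  ring is left open: counting arguments use integers, span arguments rationals.\<close>

definition pairing :: "'i set \<Rightarrow> ('i \<Rightarrow> 'a::comm_ring_1) \<Rightarrow> ('i \<Rightarrow> 'a) \<Rightarrow> 'a" where
  "pairing D f x = (\<Sum>i\<in>D. f i * x i)"

lemma pairing_add_right: "pairing D f (\<lambda>i. x i + c * v i) = pairing D f x + c * pairing D f v"
  by (simp add: pairing_def algebra_simps sum.distrib sum_distrib_left)

lemma pairing_diff_right: "pairing D f (\<lambda>i. x i - y i) = pairing D f x - pairing D f y"
  by (simp add: pairing_def algebra_simps sum_subtractf)

lemma abs_pairing_le: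
  fixes f x :: "'i \<Rightarrow> int"
  assumes "\<And>i. i \<in> D \<Longrightarrow> \<bar>f i\<bar> \<le> a" "\<And>i. i \<in> D \<Longrightarrow> \<bar>x i\<bar> \<le> b"
  shows "\<bar>pairing D f x\<bar> \<le> int (card D) * (a * b)"
proof -
  have "\<bar>pairing D f x\<bar> \<le> (\<Sum>i\<in>D. \<bar>f i * x i\<bar>)"
    unfolding pairing_def by (rule sum_abs)
  also have "\<dots> \<le> (\<Sum>i\<in>D. a * b)"
  proof (rule sum_mono)
    fix i assume "i \<in> D"
    with assms have "\<bar>f i\<bar> \<le> a" "\<bar>x i\<bar> \<le> b" by auto
    then show "\<bar>f i * x i\<bar> \<le> a * b"
      unfolding abs_mult by (intro mult_mono) auto
  qed
  finally show ?thesis by simp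
qed

text \<open>Pigeonhole: the forms in \<open>B\<close> produce fewer value vectors on a box of side
  \<open>N\<close> than the box has points, so two points agree on all of \<open>B\<close>, and
  their difference is the solution.\<close>

lemma siegel:
  fixes B :: "('i \<Rightarrow> int) set" and m :: nat
  assumes D: "finite D" and B: "finite B" "card B < card D"
    and bound: "\<And>g i. g \<in> B \<Longrightarrow> i \<in> D \<Longrightarrow> \<bar>g i\<bar> \<le> int m" and m: "m \<ge> 1"
  shows "\<exists>x. (\<forall>i\<in>D. \<bar>x i\<bar> \<le> int ((2 * card D * m) ^ card D)) \<and> (\<exists>i\<in>D. x i \<noteq> 0) \<and>
    (\<forall>g\<in>B. pairing D g x = 0)"
proof -
  define d where "d = card D"
  \<comment> \<open>On the box a form is at most \<open>d * m * N\<close> in absolute value, so it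
    takes at most \<open>M * N + 1\<close> values. With at most \<open>d - 1\<close> forms the count
    then needs \<open>M ^ (d - 1) < N + 1\<close>.\<close>
  define M where "M = 2 * d * m"
  define N where "N = M ^ d"
  define X where "X = D \<rightarrow>\<^sub>E {0..int N}"
  define Y where "Y = B \<rightarrow>\<^sub>E {- int (d * m * N)..int (d * m * N)}"
  define \<Phi> where "\<Phi> x = restrict (\<lambda>g. pairing D g x) B" for x
  have d: "d \<ge> 1" using B by (simp add: d_def)
  have M: "M \<ge> 1" using d m by (simp add: M_def)
  have cX: "card X = (N + 1) ^ d"
    using D by (simp add: X_def card_PiE d_def nat_add_distrib)
  have "nat (int (d * m * N) - (- int (d * m * N)) + 1) = M * N + 1"
    unfolding M_def by linarith
  then have cY: "card Y = (M * N + 1) ^ card B"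
    using B by (simp add: Y_def card_PiE)
  have fY: "finite Y" using B by (simp add: Y_def finite_PiE)
  have sub: "\<Phi> ` X \<subseteq> Y"
  proof
    fix z assume "z \<in> \<Phi> ` X"
    then obtain x where x: "x \<in> X" "z = \<Phi> x" by auto
    have "\<bar>pairing D g x\<bar> \<le> int (card D) * (int m * int N)" if "g \<in> B" for g
      by (rule abs_pairing_le) (use that bound x in \<open>auto simp: X_def PiE_def Pi_def\<close>)
    then have "\<bar>pairing D g x\<bar> \<le> int (d * m * N)" if "g \<in> B" for g
      using that by (simp add: d_def mult.assoc)
    then show "z \<in> Y"
      unfolding Y_def x \<Phi>_def by (auto simp: abs_le_iff minus_le_iff)
  qed
  have "card (\<Phi> ` X) \<le> card Y" using sub fY by (rule card_mono[rotated])
  also have "\<dots> \<le> (M * N + 1) ^ (d - 1)"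
    unfolding cY using B by (intro power_increasing) (auto simp: d_def)
  also have "\<dots> \<le> (M * (N + 1)) ^ (d - 1)"
    using M by (intro power_mono) auto
  also have "\<dots> = M ^ (d - 1) * (N + 1) ^ (d - 1)" by (rule power_mult_distrib)
  also have "\<dots> < (N + 1) * (N + 1) ^ (d - 1)"
  proof -
    have "M ^ (d - 1) \<le> N" unfolding N_def using M by (intro power_increasing) auto
    then show ?thesis by (intro mult_strict_right_mono) auto
  qed
  also have "\<dots> = card X" unfolding cX using d by (metis power_eq_if not_one_le_zero)
  finally have "\<not> inj_on \<Phi> X" by (rule pigeonhole)
  then obtain x y where xy: "x \<in> X" "y \<in> X" "\<Phi> x = \<Phi> y" "x \<noteq> y" by (auto simp: inj_on_def)
  then obtain i where i: "i \<in> D" "x i \<noteq> y i" unfolding X_def by (meson PiE_ext)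
  have k: "pairing D g (\<lambda>i. x i - y i) = 0" if "g \<in> B" for g
    using fun_cong[OF xy(3), of g] that by (simp add: \<Phi>_def pairing_diff_right)
  have "\<bar>x i - y i\<bar> \<le> int N" if "i \<in> D" for i
  proof -
    have "x i \<in> {0..int N}" "y i \<in> {0..int N}" using xy that by (auto simp: X_def)
    then show ?thesis by auto
  qed
  then show ?thesis using i k
    by (intro exI[of _ "\<lambda>i. x i - y i"]) (auto simp: N_def M_def d_def)
qed

section \<open>Separating one form from the relations of a vector\<close>

interpretation fun_space: vector_space "\<lambda>(c::rat) (f::'i \<Rightarrow> rat) i. c * f i"
  by unfold_locales (auto simp: fun_eq_iff algebra_simps)

text \<open>The forms that vanish at \<open>x\<close> make up a subspace.\<close>

lemma pairing_span_eq_0: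
  assumes "\<And>g. g \<in> S \<Longrightarrow> pairing D g x = 0" "g \<in> fun_space.span S"
  shows "pairing D g x = 0"
proof -
  have "fun_space.span S \<subseteq> {g. pairing D g x = 0}"
  proof (rule fun_space.span_minimal)
    show "S \<subseteq> {g. pairing D g x = 0}" using assms by auto
    show "fun_space.subspace {g. pairing D g x = 0}"
      unfolding fun_space.subspace_def
      by (auto simp: pairing_def algebra_simps sum.distrib simp flip: sum_distrib_left)
  qed
  with assms show ?thesis by auto
qed

text \<open>Removing \<open>f\<close> from the basis leaves fewer than \<open>card D\<close> forms,
  the room that Siegel's lemma needs. The basis is taken from \<open>E D\<close>, so the bound does
  not depend on the size of \<open>y\<close>.\<close>

lemma small_separating_vector:
  fixes y :: "'i \<Rightarrow> int" and m :: nat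
  defines "E \<equiv> \<lambda>D. D \<rightarrow>\<^sub>E {- int m..int m}"
  assumes D: "finite D" and m: "m \<ge> 1" and f: "f \<in> E D" "pairing D f y \<noteq> 0"
  shows "\<exists>x. (\<forall>i\<in>D. \<bar>x i\<bar> \<le> int ((2 * card D * m) ^ card D)) \<and> pairing D f x \<noteq> 0 \<and>
    (\<forall>g\<in>E D. pairing D g y = 0 \<longrightarrow> pairing D g x = 0)"
proof -
  \<comment> \<open>Elements of \<open>E D\<close> are \<open>undefined\<close> off
    \<open>D\<close>; putting 0 there makes each form a combination of the images of the unit forms
    \<open>u i\<close>.\<close>
  define q :: "('i \<Rightarrow> int) \<Rightarrow> 'i \<Rightarrow> rat" where "q g = (\<lambda>i. if i \<in> D then of_int (g i) else 0)" for g
  define R where "R = {g \<in> E D. pairing D g y = 0}"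
  define u where "u i = restrict (\<lambda>j. if j = i then 1 else 0 :: int) D" for i
  have q: "pairing D (q g) (\<lambda>i. of_int (z i)) = of_int (pairing D g z)" for g z
    by (simp add: pairing_def q_def)
  \<comment> \<open>The unit forms have height 1, so a maximal independent set of forms from
    \<open>E D\<close> spans all of them.\<close>
  have u: "u i \<in> E D" for i using m by (auto simp: u_def E_def)
  have pu: "pairing D (u i) z = z i" if "i \<in> D" for i z
  proof -
    have "pairing D (u i) z = (\<Sum>j\<in>D. if j = i then z j else 0)"
      unfolding pairing_def by (rule sum.cong) (auto simp: u_def)
    then show ?thesis using that D by simp
  qed
  obtain B0 where B0: "B0 \<subseteq> q ` R" "fun_space.independent B0" "q ` R \<subseteq> fun_space.span B0"
    using fun_space.maximal_independent_subset by blast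
  have "pairing D (q g) (\<lambda>i. of_int (y i)) = 0" if "g \<in> R" for g
    using that unfolding q by (simp add: R_def)
  \<comment> \<open>Everything in the span of \<open>B0\<close> vanishes at \<open>y\<close>, but
    \<open>f\<close> does not.\<close>
  then have qf: "q f \<notin> fun_space.span B0"
    using pairing_span_eq_0[of B0 D "\<lambda>i. of_int (y i)" "q f"] B0(1) f(2) q[of f y] by auto
  then have "fun_space.independent (insert (q f) B0)"
    using B0(2) by (rule fun_space.independent_insertI)
  moreover have "insert (q f) B0 \<subseteq> q ` E D" using f B0(1) by (auto simp: R_def)
  ultimately obtain B where B: "insert (q f) B0 \<subseteq> B" "B \<subseteq> q ` E D"
      "fun_space.independent B" "q ` E D \<subseteq> fun_space.span B"
    using fun_space.maximal_independent_subset_extend by blast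
  \<comment> \<open>This bounds the independent set \<open>B\<close> by the number of unit forms,
    \<open>card D\<close>.\<close>
  have "B \<subseteq> fun_space.span ((\<lambda>i. q (u i)) ` D)"
  proof
    fix b assume "b \<in> B"
    then obtain g where g: "b = q g" using B(2) by auto
    have "b = (\<Sum>i\<in>D. (\<lambda>j. q g i * q (u i) j))"
    proof
      fix j
      have "(\<Sum>i\<in>D. (\<lambda>j. q g i * q (u i) j)) j = (\<Sum>i\<in>D. q g i * q (u i) j)"
        using D by (induction D rule: finite_induct) auto
      also have "\<dots> = (\<Sum>i\<in>D. if i = j then q g j else 0)"
        by (rule sum.cong) (auto simp: q_def u_def)
      also have "\<dots> = b j" using D by (auto simp: g q_def)
      finally show "b j = (\<Sum>i\<in>D. (\<lambda>j. q g i * q (u i) j)) j" by simp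
    qed
    also have "\<dots> \<in> fun_space.span ((\<lambda>i. q (u i)) ` D)"
      by (intro fun_space.span_sum fun_space.span_scale fun_space.span_base) auto
    finally show "b \<in> fun_space.span ((\<lambda>i. q (u i)) ` D)" .
  qed
  then have "finite B" "card B \<le> card ((\<lambda>i. q (u i)) ` D)"
    using fun_space.independent_span_bound[OF finite_imageI[OF D] B(3)] by auto
  then have fB: "finite B" "card B \<le> card D" using card_image_le[OF D] le_trans by blast+
  have "B - {q f} \<subseteq> q ` E D" using B(2) by auto
  \<comment> \<open>Choosing integer preimages injectively keeps the count: \<open>G\<close> has one
    element fewer than \<open>B\<close>.\<close>
  then obtain G where G: "G \<subseteq> E D" "inj_on q G" "B - {q f} = q ` G"
    unfolding subset_image_inj by metis
  have "card G = card (B - {q f})" using G by (simp add: card_image)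
  also have "\<dots> < card B" using fB B(1) by (intro card_Diff1_less) auto
  finally have "card G < card D" using fB by simp
  moreover have "finite G" using G fB finite_image_iff by (metis finite_Diff)
  moreover have "\<bar>g i\<bar> \<le> int m" if "g \<in> G" "i \<in> D" for g i
  proof -
    have "g i \<in> {- int m..int m}" using G(1) that unfolding E_def by (meson PiE_mem subsetD)
    then show ?thesis by auto
  qed
  ultimately obtain x where x: "\<forall>i\<in>D. \<bar>x i\<bar> \<le> int ((2 * card D * m) ^ card D)"
      "\<exists>i\<in>D. x i \<noteq> 0" "\<forall>g\<in>G. pairing D g x = 0"
    using siegel[OF D _ _ _ m, of G] by metis
  let ?x = "\<lambda>i. of_int (x i) :: rat"
  have kill: "pairing D b ?x = 0" if "b \<in> B" "b \<noteq> q f" for b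
  proof -
    have "b \<in> q ` G" using that G(3) by blast
    then show ?thesis using x(3) q[of _ x] by auto
  qed
  \<comment> \<open>Otherwise all of \<open>B\<close>, and with it every unit form, would vanish at
    \<open>x\<close>, making all coordinates on \<open>D\<close> zero.\<close>
  have "pairing D f x \<noteq> 0"
  proof
    assume "pairing D f x = 0"
    then have *: "pairing D b ?x = 0" if "b \<in> B" for b
      using kill that q[of f x] by (cases "b = q f") auto
    have "x i = 0" if "i \<in> D" for i
    proof -
      have "q (u i) \<in> fun_space.span B" using B(4) u by auto
      then have "pairing D (q (u i)) ?x = 0" using pairing_span_eq_0[of B] * by blast
      then show ?thesis unfolding q using pu[OF that] by simp
    qed
    then show False using x(2) by blast
  qed
  moreover have "pairing D g x = 0" if "g \<in> E D" "pairing D g y = 0" for g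
  proof -
    have "q g \<in> fun_space.span B0" using that B0(3) by (auto simp: R_def)
    moreover have "pairing D b ?x = 0" if "b \<in> B0" for b
    proof (rule kill)
      show "b \<in> B" using that B(1) by auto
      show "b \<noteq> q f" using that qf fun_space.span_base by blast
    qed
    ultimately have "pairing D (q g) ?x = 0" using pairing_span_eq_0[of B0] by blast
    then show ?thesis unfolding q by simp
  qed
  ultimately show ?thesis using x(1) by blast
qed

section \<open>Combining the separating vectors\<close>

text \<open>Induction on \<open>S\<close>: a new form is handled by moving \<open>x\<close> along
  its vector \<open>v\<close> by a multiple \<open>n\<close> that keeps all earlier forms nonzero.
  The \<open>c\<close>-th step adds at most \<open>c * H\<close>, whence the square.\<close>

lemma avoid_hyperplanes:
  fixes S R :: "('i \<Rightarrow> int) set" and H :: nat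
  assumes "finite S"
    and "\<And>f. f \<in> S \<Longrightarrow> \<exists>v. (\<forall>i\<in>D. \<bar>v i\<bar> \<le> int H) \<and> pairing D f v \<noteq> 0 \<and>
      (\<forall>g\<in>R. pairing D g v = 0)"
  shows "\<exists>x. (\<forall>i\<in>D. \<bar>x i\<bar> \<le> int ((card S)\<^sup>2 * H)) \<and> (\<forall>f\<in>S. pairing D f x \<noteq> 0) \<and>
      (\<forall>g\<in>R. pairing D g x = 0)"
  using assms
proof (induction S rule: finite_induct)
  case empty
  show ?case by (intro exI[of _ "\<lambda>_. 0"]) (simp add: pairing_def)
next
  case (insert f S)
  obtain x where x: "\<forall>i\<in>D. \<bar>x i\<bar> \<le> int ((card S)\<^sup>2 * H)" "\<forall>f\<in>S. pairing D f x \<noteq> 0"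
      "\<forall>g\<in>R. pairing D g x = 0"
    using insert.IH insert.prems by blast
  obtain v where v: "\<forall>i\<in>D. \<bar>v i\<bar> \<le> int H" "pairing D f v \<noteq> 0" "\<forall>g\<in>R. pairing D g v = 0"
    using insert.prems by blast
  define c where "c = card (insert f S)"
  define bad where "bad g = {n :: int. pairing D g x + n * pairing D g v = 0}" for g
  have bad: "finite (bad g) \<and> card (bad g) \<le> 1" if "g \<in> insert f S" for g
  proof -
    have "a = b" if "a \<in> bad g" "b \<in> bad g" for a b
    proof -
      have "(a - b) * pairing D g v = 0"
        using that unfolding bad_def left_diff_distrib mem_Collect_eq by linarith
      \<comment> \<open>If this were 0, \<open>g\<close> would differ from \<open>f\<close>, hence
        be nonzero at \<open>x\<close>, and \<open>bad g\<close> would be empty.\<close>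
      moreover have "pairing D g v \<noteq> 0"
        using that x(2) v(2) \<open>g \<in> insert f S\<close> by (auto simp: bad_def)
      ultimately show ?thesis by simp
    qed
    then have "bad g = {} \<or> (\<exists>a. bad g = {a})" by blast
    then show ?thesis by auto
  qed
  have "card (\<Union>g\<in>insert f S. bad g) \<le> (\<Sum>g\<in>insert f S. card (bad g))"
    using insert.hyps by (intro card_UN_le) auto
  also have "\<dots> \<le> (\<Sum>g\<in>insert f S. 1)" using bad by (intro sum_mono) blast
  also have "\<dots> = c" unfolding c_def by simp
  \<comment> \<open>There are \<open>c + 1\<close> candidates for \<open>n\<close> and at most
    \<open>c\<close> bad values.\<close>
  also have "c < card {0..int c}" by simp
  finally have "\<not> {0..int c} \<subseteq> (\<Union>g\<in>insert f S. bad g)"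
    using card_mono[of "\<Union>g\<in>insert f S. bad g" "{0..int c}"] bad insert.hyps
    by (meson finite_UN finite_insert not_le)
  then obtain n where "n \<in> {0..int c}" "n \<notin> (\<Union>g\<in>insert f S. bad g)" by blast
  then have n: "0 \<le> n" "n \<le> int c" "\<And>g. g \<in> insert f S \<Longrightarrow> n \<notin> bad g"
    by (simp, simp, blast)
  let ?z = "\<lambda>i. x i + n * v i"
  have "\<bar>?z i\<bar> \<le> int (c\<^sup>2 * H)" if "i \<in> D" for i
  proof -
    have "\<bar>n * v i\<bar> \<le> int c * int H"
      unfolding abs_mult using n v(1) that by (intro mult_mono) auto
    then have "\<bar>?z i\<bar> \<le> int ((card S)\<^sup>2 * H) + int c * int H"
      using x(1) that by (smt (verit))
    also have "\<dots> = int (((card S)\<^sup>2 + c) * H)" by (simp add: algebra_simps)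
    also have "\<dots> \<le> int (c\<^sup>2 * H)"
    proof -
      have "(card S)\<^sup>2 + c \<le> c\<^sup>2"
        using insert.hyps by (simp add: c_def power2_eq_square)
      then show ?thesis by (metis mult_le_mono1 of_nat_le_iff)
    qed
    finally show ?thesis .
  qed
  moreover have "\<forall>g\<in>insert f S. pairing D g ?z \<noteq> 0"
    using n(3) unfolding pairing_add_right by (auto simp: bad_def)
  moreover have "\<forall>g\<in>R. pairing D g ?z = 0"
    using x(3) v(3) unfolding pairing_add_right by simp
  ultimately show ?case unfolding c_def by (intro exI[of _ ?z] conjI ballI) auto
qed

text \<open>\<open>S\<close> and \<open>R\<close> split the forms of height at most \<open>m\<close>
  by whether they vanish at \<open>y\<close>. The factor \<open>(2 * m + 1) ^ card D\<close> counts
  all these forms and so bounds \<open>card S\<close>.\<close>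

lemma small_vector_same_relations:
  fixes y :: "'i \<Rightarrow> int" and m :: nat
  assumes D: "finite D" and m: "m \<ge> 1"
  shows "\<exists>x. (\<forall>i\<in>D. \<bar>x i\<bar> \<le> int (((2 * m + 1) ^ card D)\<^sup>2 * (2 * card D * m) ^ card D)) \<and>
    (\<forall>f. (\<forall>i\<in>D. \<bar>f i\<bar> \<le> int m) \<longrightarrow> (pairing D f x = 0 \<longleftrightarrow> pairing D f y = 0))"
proof -
  define E where "E = D \<rightarrow>\<^sub>E {- int m..int m}"
  define S where "S = {f \<in> E. pairing D f y \<noteq> 0}"
  define R where "R = {f \<in> E. pairing D f y = 0}"
  let ?H = "(2 * card D * m) ^ card D"
  have fE: "finite E" using D by (simp add: E_def finite_PiE)
  have "nat (int m - (- int m) + 1) = 2 * m + 1" by linarith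
  then have cE: "card E = (2 * m + 1) ^ card D" using D by (simp add: E_def card_PiE)
  have fS: "finite S" using fE by (simp add: S_def)
  have "\<exists>v. (\<forall>i\<in>D. \<bar>v i\<bar> \<le> int ?H) \<and> pairing D f v \<noteq> 0 \<and> (\<forall>g\<in>R. pairing D g v = 0)"
    if "f \<in> S" for f
    using small_separating_vector[OF D m, of f y] that by (auto simp: S_def R_def E_def)
  from avoid_hyperplanes[OF fS this] obtain x where
    x: "\<forall>i\<in>D. \<bar>x i\<bar> \<le> int ((card S)\<^sup>2 * ?H)" "\<forall>f\<in>S. pairing D f x \<noteq> 0"
      "\<forall>g\<in>R. pairing D g x = 0" by blast
  have "card S \<le> (2 * m + 1) ^ card D"
    unfolding cE[symmetric] using fE by (intro card_mono) (auto simp: S_def)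
  then have "(card S)\<^sup>2 * ?H \<le> ((2 * m + 1) ^ card D)\<^sup>2 * ?H"
    by (intro mult_le_mono1 power_mono) auto
  then have "\<forall>i\<in>D. \<bar>x i\<bar> \<le> int (((2 * m + 1) ^ card D)\<^sup>2 * ?H)"
    using x(1) by (meson of_nat_mono order_trans)
  moreover have "pairing D f x = 0 \<longleftrightarrow> pairing D f y = 0" if "\<forall>i\<in>D. \<bar>f i\<bar> \<le> int m" for f
  proof -
    \<comment> \<open>Members of \<open>E\<close> are extensional while \<open>f\<close> is
      arbitrary off \<open>D\<close>; the pairing sees only \<open>D\<close>.\<close>
    have r: "pairing D (restrict f D) z = pairing D f z" for z
      unfolding pairing_def by (rule sum.cong) auto
    have "restrict f D \<in> E" using that by (auto simp: E_def abs_le_iff minus_le_iff)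
    then have "restrict f D \<in> S \<and> pairing D f y \<noteq> 0 \<or> restrict f D \<in> R \<and> pairing D f y = 0"
      unfolding S_def R_def by (simp add: r)
    then show ?thesis using x(2,3) r by metis
  qed
  ultimately show ?thesis by blast
qed

section \<open>Freiman isomorphisms and dissociated sets\<close>

lemma signed_int: "e \<in> {-1, 0, 1} \<Longrightarrow> signed e (x::int) = e * x"
  by (auto simp: signed_def)

text \<open>The equivalence serves both homomorphism conditions: a relation in the image is pulled
  back through \<open>inv_into\<close>.\<close>

lemma F_isomorphic_image:
  assumes inj: "inj_on \<psi> A"
    and iff: "\<And>a \<epsilon>. \<forall>j<l. a j \<in> A \<and> \<epsilon> j \<in> {-1, 0, 1} \<Longrightarrow>
      (\<Sum>j<l. signed (\<epsilon> j) (a j)) = 0 \<longleftrightarrow> (\<Sum>j<l. signed (\<epsilon> j) (\<psi> (a j))) = 0"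
  shows "F_isomorphic l A (\<psi> ` A)"
  unfolding F_isomorphic_def
proof (intro exI conjI)
  show "bij_betw \<psi> A (\<psi> ` A)" using inj by (simp add: bij_betw_def)
  show "F_hom l A (\<psi> ` A) \<psi>" unfolding F_hom_def using iff by blast
  show "F_hom l (\<psi> ` A) A (inv_into A \<psi>)"
    unfolding F_hom_def
  proof (intro conjI allI impI)
    show "inv_into A \<psi> ` \<psi> ` A \<subseteq> A" using inj by simp
    fix b \<epsilon>
    assume b: "\<forall>j<l. b j \<in> \<psi> ` A \<and> \<epsilon> j \<in> {-1, 0, 1}"
      and s: "(\<Sum>j<l. signed (\<epsilon> j) (b j)) = 0"
    have "(\<Sum>j<l. signed (\<epsilon> j) (\<psi> (inv_into A \<psi> (b j)))) = (\<Sum>j<l. signed (\<epsilon> j) (b j))"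
      using b by (intro sum.cong) (auto simp: f_inv_into_f)
    moreover have "\<forall>j<l. inv_into A \<psi> (b j) \<in> A \<and> \<epsilon> j \<in> {-1, 0, 1}"
      using b by (auto intro: inv_into_into)
    ultimately show "(\<Sum>j<l. signed (\<epsilon> j) (inv_into A \<psi> (b j))) = 0"
      using iff[of "\<lambda>j. inv_into A \<psi> (b j)" \<epsilon>] s by simp
  qed
qed

lemma F_isomorphic_refl: "F_isomorphic l A A"
  using F_isomorphic_image[of "\<lambda>x. x" A l] by simp

lemma dissociated_nonzero:
  assumes "dissociated D" "d \<in> D" shows "d \<noteq> 0"
proof
  assume "d = 0"
  then show False
    using assms(1)[unfolded dissociated_def, rule_format, of "{d}" "\<lambda>_. 1" d] assms(2)
    by (simp add: signed_def)
qed

text \<open>A nontrivial relation on \<open>insert a D\<close> must involve \<open>a\<close>, since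
  \<open>D\<close> admits none; it can then be solved for \<open>a\<close>.\<close>

lemma maximal_dissociated_spans:
  fixes D :: "int set"
  assumes D: "finite D" "dissociated D" and a: "\<not> dissociated (insert a D)"
  shows "\<exists>c. (\<forall>d. c d \<in> {-1, 0, 1}) \<and> a = (\<Sum>d\<in>D. c d * d)"
proof -
  obtain F \<epsilon> where F: "finite F" "F \<subseteq> insert a D" "\<forall>d\<in>F. \<epsilon> d \<in> {-1, 0, 1}"
      "(\<Sum>d\<in>F. signed (\<epsilon> d) d) = 0" "\<exists>d\<in>F. \<epsilon> d \<noteq> (0::int)"
    using a unfolding dissociated_def by blast
  have s: "(\<Sum>d\<in>F. \<epsilon> d * d) = 0"
    using F(3,4) by (simp add: signed_int)
  have aD: "a \<notin> D" using a D(2) by (auto simp: insert_absorb)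
  have sF: "(\<Sum>d\<in>F - {a}. signed (\<epsilon> d) d) = (\<Sum>d\<in>F - {a}. \<epsilon> d * d)"
    using F(3) by (intro sum.cong) (auto simp: signed_int)
  have aF: "a \<in> F \<and> \<epsilon> a \<noteq> 0"
  proof (rule ccontr)
    assume n: "\<not> (a \<in> F \<and> \<epsilon> a \<noteq> 0)"
    have "(\<Sum>d\<in>F - {a}. \<epsilon> d * d) = 0"
      using n s F(1) by (cases "a \<in> F") (auto simp: sum.remove[of F a])
    then have "\<forall>d\<in>F - {a}. \<epsilon> d = 0"
      using D(2)[unfolded dissociated_def, rule_format, of "F - {a}" \<epsilon>] F sF by auto
    then show False using n F(5) by auto
  qed
  \<comment> \<open>The coefficient \<open>\<epsilon> a\<close> is 1 or -1, its own inverse, so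
    solving for \<open>a\<close> keeps all coefficients in \<open>{-1, 0, 1}\<close>.\<close>
  define c where "c d = (if d \<in> F - {a} then - \<epsilon> a * \<epsilon> d else 0)" for d
  have sq: "\<epsilon> a * \<epsilon> a = 1" using aF F(3) by auto
  have "\<epsilon> a * a + (\<Sum>d\<in>F - {a}. \<epsilon> d * d) = 0"
    using s aF F(1) by (simp add: sum.remove[of F a])
  then have "\<epsilon> a * (\<epsilon> a * a) = \<epsilon> a * (- (\<Sum>d\<in>F - {a}. \<epsilon> d * d))"
    unfolding eq_neg_iff_add_eq_0[symmetric] by (rule arg_cong)
  then have "a = (\<Sum>d\<in>F - {a}. c d * d)"
    using sq by (simp add: c_def sum_distrib_left mult.assoc[symmetric] sum_negf)
  also have "\<dots> = (\<Sum>d\<in>D. c d * d)"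
    using D(1) F(2) by (intro sum.mono_neutral_left) (auto simp: c_def)
  finally have "a = (\<Sum>d\<in>D. c d * d)" .
  moreover have "c d \<in> {-1, 0, 1}" for d
  proof -
    have "\<epsilon> a \<in> {-1, 1}" using F(3) aF by auto
    then show ?thesis using F(3) by (auto simp: c_def)
  qed
  ultimately show ?thesis by blast
qed

text \<open>A \<open>D\<close> of maximum size cannot be enlarged inside \<open>A\<close>, so
  elements outside \<open>D\<close> are spanned by it; those in \<open>D\<close> represent
  themselves.\<close>

lemma ex_dissociated_basis:
  fixes A :: "int set"
  assumes "finite A"
  shows "\<exists>D c. D \<subseteq> A \<and> dissociated D \<and> card D = additive_dim A \<and>
    (\<forall>a\<in>A. (\<forall>d. c a d \<in> {-1, 0, 1::int}) \<and> a = (\<Sum>d\<in>D. c a d * d))"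
proof -
  let ?P = "{D. D \<subseteq> A \<and> dissociated D}"
  have fin: "finite ?P" using assms by simp
  have "{} \<in> ?P" by (simp add: dissociated_def)
  then have "additive_dim A \<in> card ` ?P"
    unfolding additive_dim_def using fin by (intro Max_in) auto
  then obtain D where D: "D \<subseteq> A" "dissociated D" "card D = additive_dim A" by auto
  have fD: "finite D" using D(1) assms by (rule finite_subset)
  have "\<exists>c. (\<forall>d. c d \<in> {-1, 0, 1::int}) \<and> a = (\<Sum>d\<in>D. c d * d)" if "a \<in> A" for a
  proof (cases "a \<in> D")
    case True
    have "(\<Sum>d\<in>D. (if d = a then 1 else 0) * d) = (\<Sum>d\<in>D. if d = a then a else 0)"
      by (rule sum.cong) auto
    then show ?thesis using True fD
      by (intro exI[of _ "\<lambda>d. if d = a then 1 else 0"]) auto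
  next
    case False
    have "\<not> dissociated (insert a D)"
    proof
      assume "dissociated (insert a D)"
      then have "card (insert a D) \<le> additive_dim A"
        unfolding additive_dim_def using fin D(1) that by (intro Max_ge) auto
      then show False using False fD D(3) by simp
    qed
    then show ?thesis using maximal_dissociated_spans fD D(2) by blast
  qed
  then show ?thesis using D by metis
qed

section \<open>Transfer to a short vector\<close>

text \<open>Replacing each \<open>d\<close> by \<open>x d\<close> in the fixed expansion of
  \<open>a\<close> over \<open>D\<close> gives the isomorphism. Expansion coefficients are at most 1
  in absolute value, so images are at most \<open>card D * H\<close>.\<close>

lemma F_isomorphic_of_same_relations:
  fixes A D :: "int set"
  assumes fD: "finite D"
    and c: "\<And>a. a \<in> A \<Longrightarrow> (\<forall>d. c a d \<in> {-1, 0, 1::int}) \<and> a = (\<Sum>d\<in>D. c a d * d)"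
    and x: "\<And>f. \<forall>d\<in>D. \<bar>f d\<bar> \<le> int (max 2 l) \<Longrightarrow>
      pairing D f x = 0 \<longleftrightarrow> pairing D f (\<lambda>d. d) = 0"
    and h: "\<And>d. d \<in> D \<Longrightarrow> \<bar>x d\<bar> \<le> int H"
  shows "\<exists>B \<subseteq> {- int (card D * H)..int (card D * H)}. F_isomorphic l A B"
proof -
  define \<psi> where "\<psi> a = pairing D (c a) x" for a
  have c': "\<bar>c a d\<bar> \<le> 1" if "a \<in> A" for a d using c[OF that] by (auto dest!: spec[of _ d])
  have a: "a = pairing D (c a) (\<lambda>d. d)" if "a \<in> A" for a
    using c[OF that] by (simp add: pairing_def)
  have inj: "inj_on \<psi> A"
  proof (rule inj_onI)
    fix a b assume ab: "a \<in> A" "b \<in> A" "\<psi> a = \<psi> b"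
    have lin: "pairing D (\<lambda>d. c a d - c b d) z = pairing D (c a) z - pairing D (c b) z" for z
      by (simp add: pairing_def algebra_simps sum_subtractf)
    have "pairing D (\<lambda>d. c a d - c b d) x = 0" using ab(3) by (simp add: lin \<psi>_def)
    moreover have "\<bar>c a d - c b d\<bar> \<le> int (max 2 l)" for d
      using c'[OF ab(1), of d] c'[OF ab(2), of d] by linarith
    ultimately have "pairing D (\<lambda>d. c a d - c b d) (\<lambda>d. d) = 0"
      using x[of "\<lambda>d. c a d - c b d"] by simp
    then show "a = b" using a ab(1,2) by (simp add: lin)
  qed
  have iff: "(\<Sum>j<l. signed (\<epsilon> j) (s j)) = 0 \<longleftrightarrow> (\<Sum>j<l. signed (\<epsilon> j) (\<psi> (s j))) = 0"
    if s: "\<forall>j<l. s j \<in> A \<and> \<epsilon> j \<in> {-1, 0, 1}" for s \<epsilon>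
  proof -
    \<comment> \<open>Collecting the \<open>l\<close> expansions by elements of \<open>D\<close>
      gives a single form, of height at most \<open>l\<close>.\<close>
    define f where "f d = (\<Sum>j<l. \<epsilon> j * c (s j) d)" for d
    have lin: "(\<Sum>j<l. signed (\<epsilon> j) (pairing D (c (s j)) z)) = pairing D f z" for z
    proof -
      have "(\<Sum>j<l. signed (\<epsilon> j) (pairing D (c (s j)) z))
          = (\<Sum>j<l. \<epsilon> j * pairing D (c (s j)) z)"
        using s by (intro sum.cong) (auto simp: signed_int)
      also have "\<dots> = (\<Sum>j<l. \<Sum>d\<in>D. \<epsilon> j * c (s j) d * z d)"
        by (simp add: pairing_def sum_distrib_left mult.assoc)
      also have "\<dots> = pairing D f z"
        unfolding pairing_def f_def sum_distrib_right by (rule sum.swap)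
      finally show ?thesis .
    qed
    have "\<bar>f d\<bar> \<le> int (max 2 l)" for d
    proof -
      have "\<bar>f d\<bar> \<le> (\<Sum>j<l. \<bar>\<epsilon> j * c (s j) d\<bar>)" unfolding f_def by (rule sum_abs)
      also have "\<dots> \<le> (\<Sum>j<l. 1)"
      proof (rule sum_mono)
        fix j assume "j \<in> {..<l}"
        then have "\<bar>\<epsilon> j\<bar> \<le> 1" "\<bar>c (s j) d\<bar> \<le> 1" using s c' by auto
        then show "\<bar>\<epsilon> j * c (s j) d\<bar> \<le> 1" unfolding abs_mult by (intro mult_le_one) auto
      qed
      finally show ?thesis by simp
    qed
    then have "pairing D f x = 0 \<longleftrightarrow> pairing D f (\<lambda>d. d) = 0" using x by blast
    moreover have "(\<Sum>j<l. signed (\<epsilon> j) (s j)) =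
        (\<Sum>j<l. signed (\<epsilon> j) (pairing D (c (s j)) (\<lambda>d. d)))"
      using s a by (intro sum.cong) auto
    ultimately show ?thesis unfolding \<psi>_def by (simp add: lin)
  qed
  have "\<psi> ` A \<subseteq> {- int (card D * H)..int (card D * H)}"
  proof
    fix b assume "b \<in> \<psi> ` A"
    then obtain s where s: "s \<in> A" "b = \<psi> s" by auto
    have "\<bar>b\<bar> \<le> int (card D) * (1 * int H)"
      unfolding s(2) \<psi>_def using c'[OF s(1)] h by (rule abs_pairing_le)
    then show "b \<in> {- int (card D * H)..int (card D * H)}" by auto
  qed
  then show ?thesis using F_isomorphic_image[OF inj iff] by blast
qed

section \<open>Numerical bound and conclusion\<close>

text \<open>Apart from \<open>n ^ n\<close>, all factors are absorbed into powers of
  \<open>m\<close>: the exponents are \<open>n\<close> from the leading factor, \<open>6 * n\<close>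
  from the square and \<open>2 * n\<close> from \<open>2 * m \<le> m * m\<close>, in total
  \<open>9 * n\<close>.\<close>

lemma height_bound:
  fixes m n :: nat
  assumes m: "m \<ge> 2" and n: "n \<ge> 2"
  shows "real (n * (((2 * m + 1) ^ n)\<^sup>2 * (2 * n * m) ^ n))
    \<le> real m powr (20 * real n * ln (real n))"
proof -
  have "2 * m + 1 \<le> m ^ 3"
  proof -
    have "2 * 2 * m \<le> m * m * m" using m by (intro mult_le_mono) auto
    then show ?thesis using m unfolding power3_eq_cube by linarith
  qed
  then have 1: "((2 * m + 1) ^ n)\<^sup>2 \<le> ((m ^ 3) ^ n)\<^sup>2" by (intro power_mono) auto
  have "n \<le> 2 ^ n" using less_exp[of n] by simp
  also have "(2::nat) ^ n \<le> m ^ n" using m by (intro power_mono) auto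
  finally have 2: "n \<le> m ^ n" .
  have "(2 * n * m) ^ n \<le> (m * m * n) ^ n"
    using m by (intro power_mono) auto
  then have "n * (((2 * m + 1) ^ n)\<^sup>2 * (2 * n * m) ^ n)
      \<le> m ^ n * (((m ^ 3) ^ n)\<^sup>2 * (m * m * n) ^ n)"
    using 1 2 by (intro mult_le_mono)
  also have "\<dots> = m ^ (9 * n) * n ^ n"
    by (simp add: power_mult_distrib power_mult[symmetric] power_add[symmetric] mult.assoc[symmetric])
  finally have "real (n * (((2 * m + 1) ^ n)\<^sup>2 * (2 * n * m) ^ n)) \<le> real (m ^ (9 * n) * n ^ n)"
    by (simp only: of_nat_le_iff)
  also have "\<dots> = exp (ln (real m)) ^ (9 * n) * exp (ln (real n)) ^ n" using m n by simp
  also have "\<dots> = exp (9 * real n * ln m + real n * ln n)"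
    unfolding exp_of_nat_mult[symmetric] exp_add by simp
  \<comment> \<open>Both logarithms are at least 1/2, so each term may gain twice the missing one:
    \<open>9 * 2 + 2 = 20\<close>.\<close>
  also have "\<dots> \<le> exp (20 * real n * ln n * ln m)"
  proof -
    have l2: "ln (2::real) \<ge> 1 / 2" using exp_half_le2 by (subst ln_ge_iff) auto
    have lm: "ln (real m) \<ge> 1 / 2" by (rule order_trans[OF l2 ln_mono]) (use m in auto)
    have ln: "ln (real n) \<ge> 1 / 2" by (rule order_trans[OF l2 ln_mono]) (use n in auto)
    have "real n * ln m * 1 \<le> real n * ln m * (2 * ln n)" using lm ln by (intro mult_left_mono) auto
    moreover have "real n * ln n * 1 \<le> real n * ln n * (2 * ln m)" using lm ln by (intro mult_left_mono) auto
    ultimately have "9 * real n * ln m + real n * ln n \<le> 20 * real n * ln n * ln m"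
      by (simp add: algebra_simps)
    then show ?thesis by simp
  qed
  also have "\<dots> = real m powr (20 * real n * ln (real n))" using m by (simp add: powr_def)
  finally show ?thesis .
qed

theorem theorem6p2:
  shows "\<exists>C K :: real. C > 0 \<and> K > 0 \<and>
    (\<forall>(l :: nat) (k :: int) (A :: int set).
       l \<ge> 1 \<longrightarrow> finite A \<longrightarrow>
       (\<forall>A' :: int set. F_isomorphic l A' A \<longrightarrow> int (additive_dim A') \<le> k) \<longrightarrow>
       (\<exists>(T :: nat) (B :: int set).
          real T \<le> C * real (max 2 l) powr (K * real_of_int k * ln (real_of_int k)) \<and>
          B \<subseteq> {- int T .. int T} \<and>
          F_isomorphic l A B))"
\<comment> \<open>The exponent constant 20 is that of \<open>height_bound\<close>, which has no
  leading factor.\<close>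
proof (rule exI[of _ 1], rule exI[of _ 20], intro conjI allI impI)
  fix l :: nat and k :: int and A :: "int set"
  assume A: "finite A"
    and dim: "\<forall>A' :: int set. F_isomorphic l A' A \<longrightarrow> int (additive_dim A') \<le> k"
  obtain D c where D: "D \<subseteq> A" "dissociated D" "card D = additive_dim A"
    and c: "\<And>a. a \<in> A \<Longrightarrow> (\<forall>d. c a d \<in> {-1, 0, 1::int}) \<and> a = (\<Sum>d\<in>D. c a d * d)"
    using ex_dissociated_basis[OF A] by metis
  have fD: "finite D" using D(1) A by (rule finite_subset)
  have k: "int (card D) \<le> k" using dim F_isomorphic_refl D(3) by metis
  define m where "m = max 2 l"
  have m: "m \<ge> 2" by (simp add: m_def)
  define n where "n = nat k"
  have kn: "real_of_int k = real n" using k by (simp add: n_def)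
  show "\<exists>(T :: nat) (B :: int set).
          real T \<le> 1 * real (max 2 l) powr (20 * real_of_int k * ln (real_of_int k)) \<and>
          B \<subseteq> {- int T .. int T} \<and> F_isomorphic l A B"
  proof (cases "card D \<le> 1")
    \<comment> \<open>For \<open>k = 1\<close> the exponent vanishes, so the bound must not depend on \<open>l\<close>.\<close>
    case True
    \<comment> \<open>For \<open>D = {d}\<close> with \<open>d \<noteq> 0\<close>, both sides say
      \<open>f d = 0\<close>, so 1 can replace \<open>d\<close>.\<close>
    have "pairing D f (\<lambda>_. 1) = 0 \<longleftrightarrow> pairing D f (\<lambda>d. d) = 0" for f
    proof (cases "D = {}")
      case False
      then obtain d where "D = {d}" using True fD
        by (metis One_nat_def card_0_eq card_1_singletonE le_Suc_eq le_zero_eq)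
      then show ?thesis using dissociated_nonzero[OF D(2)] by (simp add: pairing_def)
    qed (simp add: pairing_def)
    then obtain B where B: "B \<subseteq> {- int (card D * 1)..int (card D * 1)}" "F_isomorphic l A B"
      using F_isomorphic_of_same_relations[OF fD c, where x = "\<lambda>_. 1" and H = 1 and l = l]
      by force
    have "20 * real n * ln (real n) \<ge> 0" by (cases "n = 0") auto
    then have "1 \<le> real m powr (20 * real n * ln (real n))"
      using m by (intro ge_one_powr_ge_zero) auto
    moreover have "real (card D * 1) \<le> 1" using True by simp
    ultimately have "real (card D * 1) \<le> real m powr (20 * real n * ln (real n))"
      by (rule order_trans[rotated])
    then show ?thesis using B unfolding kn m_def by (intro exI[of _ "card D * 1"] exI[of _ B]) simp
  next
    case False
    define H where "H = ((2 * m + 1) ^ card D)\<^sup>2 * (2 * card D * m) ^ card D"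
    obtain x where x: "\<forall>d\<in>D. \<bar>x d\<bar> \<le> int H"
        "\<forall>f. (\<forall>i\<in>D. \<bar>f i\<bar> \<le> int m) \<longrightarrow> (pairing D f x = 0 \<longleftrightarrow> pairing D f (\<lambda>d. d) = 0)"
      using small_vector_same_relations[OF fD, of m "\<lambda>d. d"] m unfolding H_def by auto
    obtain B where B: "B \<subseteq> {- int (card D * H)..int (card D * H)}" "F_isomorphic l A B"
      using F_isomorphic_of_same_relations[OF fD c, where x = x and H = H and l = l] x
      unfolding m_def by blast
    have "real (card D * H) \<le> real m powr (20 * real (card D) * ln (real (card D)))"
      unfolding H_def using False m by (intro height_bound) auto
    \<comment> \<open>Here \<open>2 \<le> card D \<le> n\<close>, a range on which
      \<open>t * ln t\<close> is nonnegative and increasing.\<close>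
    also have "\<dots> \<le> real m powr (20 * real n * ln (real n))"
    proof (intro powr_mono mult_mono)
      show "ln (real (card D)) \<le> ln (real n)" using k False by (intro ln_mono) (auto simp: n_def)
    qed (use k m False in \<open>auto simp: n_def\<close>)
    finally show ?thesis using B unfolding kn m_def by (intro exI[of _ "card D * H"] exI[of _ B]) simp
  qed
qed simp_all

end
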